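(* Let $r\geq 2$, let $t\geq 0$ be an integer, let $n\geq (t+3)r-\lceil (t+2)/2\rceil$ (with $n\geq 2r+1$), and let $k=\binom{n-r}{r}-t$. Then $\gamma_{\times k}(K(n,r))=\binom{n}{r}-(t+1)$. Moreover, for every set $S$ of vertices of $K(n,r)$ with $|S|=t+1$, the set $V(K(n,r))\setminus S$ is a $k$-tuple dominating set of $K(n,r)$ of cardinality $\gamma_{\times k}(K(n,r))$.
   Context: The Kneser graph $K(n,r)$ has as vertices the $r$-subsets of $[n]=\{1,\dots,n\}$, two vertices adjacent iff disjoint. For a vertex $v$, $N[v]$ is its closed neighbourhood. A set $D$ of vertices is a $k$-tuple dominating set if $|N[v]\cap D|\geq k$ for every vertex $v$; $\gamma_{\times k}(K(n,r))$ is the minimum cardinality of such a set. *)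

theory Defs
  imports Complex_Main "Graph_Theory.Pair_Digraph"
begin

(* Simple graphs are represented as in Graph_Theory: finite, loop-free digraphs without
   parallel arcs whose arc set is symmetric (locale pair_graph). *)
definition kneser_graph :: "nat \<Rightarrow> nat \<Rightarrow> nat set pair_pre_digraph" where
  "kneser_graph n r =
     \<lparr> pverts = {v. v \<subseteq> {1..n} \<and> card v = r},
       parcs = {(u, v). u \<subseteq> {1..n} \<and> card u = r \<and> v \<subseteq> {1..n} \<and> card v = r \<and> u \<inter> v = {}} \<rparr>"

(* For r = 0 the only vertex is the empty set, which is disjoint from itself. *)
lemma pair_graph_kneser_graph:
  assumes "r \<noteq> 0"
  shows "pair_graph (kneser_graph n r)"
proof -
  have fin: "finite {v. v \<subseteq> {1..n} \<and> card v = r}"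
    by (rule finite_subset[of _ "Pow {1..n}"]) auto
  have fin': "finite (parcs (kneser_graph n r))"
    by (rule finite_subset[of _ "{v. v \<subseteq> {1..n} \<and> card v = r} \<times> {v. v \<subseteq> {1..n} \<and> card v = r}"])
      (use fin in \<open>auto simp: kneser_graph_def\<close>)
  show ?thesis
  proof unfold_locales
    show "finite (pverts (kneser_graph n r))" using fin by (simp add: kneser_graph_def)
    show "finite (parcs (kneser_graph n r))" by (fact fin')
    show "symmetric (with_proj (kneser_graph n r))"
      unfolding symmetric_def with_proj_simps by (rule symI) (simp add: kneser_graph_def Int_commute)
  next
    fix e assume e: "e \<in> parcs (kneser_graph n r)"
    show "fst e \<in> pverts (kneser_graph n r)" "snd e \<in> pverts (kneser_graph n r)"
      using e by (simp_all add: kneser_graph_def case_prod_unfold)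
    show "fst e \<noteq> snd e"
      using e assms by (fastforce simp: kneser_graph_def case_prod_unfold)
  qed
qed

definition closed_nbhd :: "'a pair_pre_digraph \<Rightarrow> 'a \<Rightarrow> 'a set" where
  "closed_nbhd G v = insert v {u. v \<rightarrow>\<^bsub>G\<^esub> u}"

definition k_tuple_dominating :: "nat \<Rightarrow> 'a pair_pre_digraph \<Rightarrow> 'a set \<Rightarrow> bool" where
  "k_tuple_dominating k G D \<longleftrightarrow>
     D \<subseteq> pverts G \<and> (\<forall>v \<in> pverts G. k \<le> card (closed_nbhd G v \<inter> D))"

(* Meant for finite graphs that have a k-tuple dominating set; unspecified if there is none. *)
definition k_tuple_domination_number :: "nat \<Rightarrow> 'a pair_pre_digraph \<Rightarrow> nat" where
  "k_tuple_domination_number k G = (LEAST m. \<exists>D. k_tuple_dominating k G D \<and> card D = m)"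

(* In the range of parameters considered, the natural-number differences
   (n - r choose r) - t and (n choose r) - (t + 1) are not truncated. *)
lemma kneser_parameters:
  fixes n r t :: nat
  assumes "r \<ge> 2" and "n \<ge> 2 * r + 1"
    and "int n \<ge> (int t + 3) * int r - \<lceil>(real t + 2) / 2\<rceil>"
  shows "t < (n - r) choose r" and "t + 1 < n choose r"
proof -
  have choose_ge: "m \<le> m choose k" if "1 \<le> k" "k < m" for m k :: nat
    using that
  proof (induction m arbitrary: k)
    case (Suc m)
    show ?case
    proof (cases "k = m \<or> k = 1")
      case True
      then show ?thesis using Suc.prems by (auto)
    next
      case False
      then obtain j where j: "k = Suc j" "1 \<le> j" "j < m" "k < m"
        using Suc.prems by (cases k) auto
      then have "m \<le> m choose k" "0 < m choose j"
        using Suc.IH[of k] Suc.prems by auto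
      then have "Suc m \<le> (m choose j) + (m choose Suc j)"
        unfolding j(1) by linarith
      then show ?thesis using j(1) by simp
    qed
  qed simp
  have ceil: "2 * \<lceil>(real t + 2) / 2\<rceil> \<le> int t + 3"
  proof -
    have "of_int \<lceil>(real t + 2) / 2\<rceil> < (real t + 2) / 2 + 1" by linarith
    then have "2 * of_int \<lceil>(real t + 2) / 2\<rceil> < real t + 4" by argo
    then have "real_of_int (2 * \<lceil>(real t + 2) / 2\<rceil>) < real_of_int (int t + 4)"
      by (simp only: of_int_mult of_int_add of_int_numeral of_int_of_nat_eq)
    then have "2 * \<lceil>(real t + 2) / 2\<rceil> < int t + 4" by (simp only: of_int_less_iff)
    then show ?thesis by linarith
  qed
  have "(int t + 2) * 2 \<le> (int t + 2) * int r"
    using assms(1) by (intro mult_left_mono) auto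
  then have "int n - int r \<ge> (int t + 2) * 2 - \<lceil>(real t + 2) / 2\<rceil>"
    using assms(3) by (simp add: algebra_simps)
  moreover have "u + 1 \<le> x" if "(u + 2) * 2 - c \<le> x" "2 * c \<le> u + 3" "0 \<le> u" for u x c :: int
    using that by presburger
  ultimately have "int t + 1 \<le> int n - int r" using ceil of_nat_0_le_iff by blast
  then have "t + 1 \<le> n - r" by linarith
  moreover have "n - r \<le> (n - r) choose r" "n \<le> n choose r"
    by (rule choose_ge; use assms(1,2) in linarith)+
  ultimately show "t < (n - r) choose r" "t + 1 < n choose r"
    using assms(1,2) by linarith+
qed

end

theory Submission
  imports Defs
begin

text \<open>
  A closed neighbourhood of the Kneser graph has \<open>(n - r choose r) + 1\<close> elements, so \<open>D\<close> is
  dominating iff no closed neighbourhood contains more than \<open>t + 1\<close> vertices outside \<open>D\<close>. It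
  remains to see that any \<open>t + 2\<close> vertices lie in a common closed neighbourhood. If one of them is
  disjoint from all the others, its own neighbourhood will do. Otherwise each of them contains a
  point covered at least twice, which makes their union so small that an \<open>r\<close>-set is left over.
\<close>

text \<open>Double counting of incidences with the multiplicity \<open>d x\<close>. All points
  together carry \<open>card F * r\<close> incidences, and the set \<open>P\<close> of repeated
  points carries at least \<open>card F\<close> of them, since every member contains a point of
  \<open>P\<close>. Each repeated point makes the union smaller than the incidence count.\<close>

lemma card_Union_each_meets_another:
  fixes F :: "'a set set"
  assumes fin: "finite F"
    and card: "\<And>A. A \<in> F \<Longrightarrow> finite A \<and> card A = r"
    and meets: "\<And>A. A \<in> F \<Longrightarrow> \<exists>B\<in>F. B \<noteq> A \<and> A \<inter> B \<noteq> {}"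
  shows "2 * card (\<Union>F) + card F \<le> 2 * (card F * r)"
proof -
  define d where "d x = card {A \<in> F. x \<in> A}" for x
  define P where "P = {x \<in> \<Union>F. 2 \<le> d x}"
  have finU: "finite (\<Union>F)" using fin card by auto
  have finP: "finite P" by (rule finite_subset[OF _ finU]) (auto simp: P_def)
  \<comment> \<open>Incidences between \<open>F\<close> and \<open>Q\<close>, counted by members and
    by points; used for the whole union and for \<open>P\<close>.\<close>
  have count: "(\<Sum>A\<in>F. card {x \<in> Q. x \<in> A}) = sum d Q" if "finite Q" for Q
    by (rule sum_multicount_gen) (use fin that in \<open>auto simp: d_def\<close>)
  have "sum d (\<Union>F) = (\<Sum>A\<in>F. card {x \<in> \<Union>F. x \<in> A})"
    using count[OF finU] by simp
  also have "\<dots> = (\<Sum>A\<in>F. r)"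
  proof (rule sum.cong)
    fix A assume A: "A \<in> F"
    then have "{x \<in> \<Union>F. x \<in> A} = A" by auto
    then show "card {x \<in> \<Union>F. x \<in> A} = r" using card[OF A] by simp
  qed simp
  finally have total: "sum d (\<Union>F) = card F * r" by simp
  have "1 \<le> card {x \<in> P. x \<in> A}" if A: "A \<in> F" for A
  proof -
    obtain B x where B: "B \<in> F" "B \<noteq> A" "x \<in> A" "x \<in> B" using meets[OF A] by blast
    have "card {A, B} \<le> d x"
      unfolding d_def by (rule card_mono) (use fin A B in auto)
    then have "x \<in> P" using A B by (auto simp: P_def)
    then have "{x \<in> P. x \<in> A} \<noteq> {}" using B by auto
    then show ?thesis using finP by (simp add: Suc_le_eq card_gt_0_iff)
  qed
  then have "(\<Sum>A\<in>F. 1) \<le> (\<Sum>A\<in>F. card {x \<in> P. x \<in> A})" by (rule sum_mono)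
  then have F_le: "card F \<le> sum d P" using count[OF finP] by simp
  have ge1: "1 \<le> d x" if "x \<in> \<Union>F" for x
    using that fin by (auto simp: d_def Suc_le_eq card_gt_0_iff)
  have "2 * card (\<Union>F) + sum d P = (\<Sum>x\<in>\<Union>F. 2 + (if 2 \<le> d x then d x else 0))"
    unfolding P_def sum.inter_filter[OF finU] sum.distrib by simp
  \<comment> \<open>Pointwise: if \<open>d x = 1\<close> both sides equal 2, and if
    \<open>d x \<ge> 2\<close> then \<open>2 + d x \<le> 2 * d x\<close>.\<close>
  also have "\<dots> \<le> (\<Sum>x\<in>\<Union>F. 2 * d x)"
    by (rule sum_mono) (use ge1 in force)
  also have "\<dots> = 2 * (card F * r)" using total by (simp flip: sum_distrib_left)
  finally show ?thesis using F_le by linarith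
qed

lemma kneser_verts: "pverts (kneser_graph n r) = {v. v \<subseteq> {1..n} \<and> card v = r}"
  by (simp add: kneser_graph_def)

lemma finite_kneser_verts: "finite (pverts (kneser_graph n r))"
  by (rule finite_subset[of _ "Pow {1..n}"]) (auto simp: kneser_verts)

lemma card_kneser_verts: "card (pverts (kneser_graph n r)) = n choose r"
  using n_subsets[of "{1..n}" r] by (simp add: kneser_verts)

lemma kneser_closed_nbhd:
  assumes "v \<in> pverts (kneser_graph n r)"
  shows "closed_nbhd (kneser_graph n r) v = insert v {u. u \<subseteq> {1..n} - v \<and> card u = r}"
  using assms by (auto simp: closed_nbhd_def kneser_graph_def)

lemma card_kneser_closed_nbhd:
  assumes v: "v \<in> pverts (kneser_graph n r)" and "r \<noteq> 0"
  shows "card (closed_nbhd (kneser_graph n r) v) = Suc ((n - r) choose r)"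
proof -
  let ?N = "{u. u \<subseteq> {1..n} - v \<and> card u = r}"
  have vs: "v \<subseteq> {1..n}" "card v = r" using v by (auto simp: kneser_verts)
  have "card ?N = (n - r) choose r"
    using n_subsets[of "{1..n} - v" r] vs by (simp add: card_Diff_subset finite_subset)
  \<comment> \<open>This is where \<open>r \<noteq> 0\<close> enters: the empty set is disjoint from
    itself, and inserting it would then add nothing to the count.\<close>
  moreover have "v \<notin> ?N" 
  proof
    assume "v \<in> ?N"
    then have "v = {}" by blast
    then show False using vs \<open>r \<noteq> 0\<close> by simp
  qed
  moreover have "finite ?N" by (rule finite_subset[of _ "Pow {1..n}"]) auto
  ultimately show ?thesis by (simp add: kneser_closed_nbhd[OF v])
qed

lemma kneser_closed_nbhd_subset:
  assumes "v \<in> pverts (kneser_graph n r)"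
  shows "closed_nbhd (kneser_graph n r) v \<subseteq> pverts (kneser_graph n r)"
  using assms by (auto simp: kneser_closed_nbhd[OF assms]) (auto simp: kneser_verts)

text \<open>Writing \<open>c\<close> for \<open>(n - r) choose r\<close>, every closed neighbourhood
  has \<open>c + 1\<close> elements, so at least \<open>c - t\<close> of them lie in
  \<open>D\<close> exactly when at most \<open>t + 1\<close> lie outside. The bound on
  \<open>t\<close> keeps the subtraction from being truncated.\<close>

lemma k_tuple_dominating_kneser_iff:
  assumes "r \<noteq> 0" and "t < (n - r) choose r"
    and D: "D \<subseteq> pverts (kneser_graph n r)"
  shows "k_tuple_dominating (((n - r) choose r) - t) (kneser_graph n r) D \<longleftrightarrow>
    (\<forall>v \<in> pverts (kneser_graph n r). card (closed_nbhd (kneser_graph n r) v - D) \<le> t + 1)"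
proof -
  have "card (closed_nbhd (kneser_graph n r) v \<inter> D) + card (closed_nbhd (kneser_graph n r) v - D)
      = Suc ((n - r) choose r)" if v: "v \<in> pverts (kneser_graph n r)" for v
    using card_Int_Diff[of "closed_nbhd (kneser_graph n r) v" D] card_kneser_closed_nbhd[OF v assms(1)]
      finite_subset[OF kneser_closed_nbhd_subset[OF v] finite_kneser_verts] by simp
  then have "((n - r) choose r) - t \<le> card (closed_nbhd (kneser_graph n r) v \<inter> D)
      \<longleftrightarrow> card (closed_nbhd (kneser_graph n r) v - D) \<le> t + 1"
    if "v \<in> pverts (kneser_graph n r)" for v
    using that assms(2) by fastforce
  then show ?thesis using D by (auto simp: k_tuple_dominating_def)
qed

text \<open>With \<open>s = card S\<close>, the bound on \<open>n\<close> leaves room for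
  \<open>r\<close> further points beside a union of at most
  \<open>s * r - \<lceil>s / 2\<rceil>\<close> points, the size allowed when every member of
  \<open>S\<close> meets another.\<close>

lemma kneser_common_closed_nbhd:
  assumes S: "S \<subseteq> pverts (kneser_graph n r)"
    and n: "int n \<ge> (int (card S) + 1) * int r - \<lceil>real (card S) / 2\<rceil>"
  shows "\<exists>v \<in> pverts (kneser_graph n r). S \<subseteq> closed_nbhd (kneser_graph n r) v"
proof (cases "\<exists>v\<in>S. \<forall>u\<in>S. u \<noteq> v \<longrightarrow> v \<inter> u = {}")
  case True
  then obtain v where v: "v \<in> S" "\<forall>u\<in>S. u \<noteq> v \<longrightarrow> v \<inter> u = {}" by blast
  then have vV: "v \<in> pverts (kneser_graph n r)" using S by auto
  have "S \<subseteq> closed_nbhd (kneser_graph n r) v"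
    unfolding kneser_closed_nbhd[OF vV] using S v by (fastforce simp: kneser_verts)
  then show ?thesis using vV by blast
next
  case False
  have finS: "finite S" using S finite_kneser_verts finite_subset by blast
  have sub: "\<Union>S \<subseteq> {1..n}" using S by (auto simp: kneser_verts)
  have "2 * card (\<Union>S) + card S \<le> 2 * (card S * r)"
  proof (rule card_Union_each_meets_another)
    show "finite A \<and> card A = r" if "A \<in> S" for A
      using that S by (auto simp: kneser_verts intro: finite_subset)
    show "\<exists>B\<in>S. B \<noteq> A \<and> A \<inter> B \<noteq> {}" if "A \<in> S" for A
      using that False by blast
  qed (fact finS)
  then have "real (2 * card (\<Union>S) + card S) \<le> real (2 * (card S * r))"
    by (rule of_nat_mono)
  \<comment> \<open>The right-hand side is an integer, so it also bounds the ceiling of the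
    left-hand side.\<close>
  then have "real (card S) / 2 \<le> real_of_int (int (card S) * int r - int (card (\<Union>S)))" by simp
  then have "\<lceil>real (card S) / 2\<rceil> \<le> int (card S) * int r - int (card (\<Union>S))"
    by (rule ceiling_le)
  then have "int n \<ge> int r + int (card (\<Union>S))"
    using n by (simp add: algebra_simps)
  then have "r \<le> card ({1..n} - \<Union>S)"
    using sub by (simp add: card_Diff_subset finite_subset)
  \<comment> \<open>A vertex avoiding the whole union is adjacent to every member of
    \<open>S\<close>.\<close>
  then obtain v where v: "v \<subseteq> {1..n} - \<Union>S" "card v = r"
    by (meson obtain_subset_with_card_n)
  then have vV: "v \<in> pverts (kneser_graph n r)" by (auto simp: kneser_verts)
  have "S \<subseteq> closed_nbhd (kneser_graph n r) v"
    unfolding kneser_closed_nbhd[OF vV]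
  proof
    fix A assume "A \<in> S"
    moreover from this have "A \<inter> v = {}" using v(1) by blast
    ultimately have "A \<subseteq> {1..n} - v" "card A = r"
      using S by (auto simp: kneser_verts)
    then show "A \<in> insert v {u. u \<subseteq> {1..n} - v \<and> card u = r}" by simp
  qed
  then show ?thesis using vV by blast
qed

theorem theorem16:
  fixes n r t k :: nat
  assumes "r \<ge> 2"
    and "int n \<ge> (int t + 3) * int r - \<lceil>(real t + 2) / 2\<rceil>"
    and "n \<ge> 2 * r + 1"
    and "k = ((n - r) choose r) - t"
  shows "k_tuple_domination_number k (kneser_graph n r) = (n choose r) - (t + 1) \<and>
    (\<forall>S. S \<subseteq> pverts (kneser_graph n r) \<and> card S = t + 1 \<longrightarrow>
       k_tuple_dominating k (kneser_graph n r) (pverts (kneser_graph n r) - S) \<and>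
       card (pverts (kneser_graph n r) - S) = k_tuple_domination_number k (kneser_graph n r))"
proof -
  let ?G = "kneser_graph n r"
  let ?V = "pverts ?G"
  have t: "t < (n - r) choose r" "t + 1 < n choose r"
    using kneser_parameters[OF assms(1,3,2)] by auto
  have r0: "r \<noteq> 0" using assms(1) by simp
  note dom_iff = k_tuple_dominating_kneser_iff[OF r0 t(1), folded assms(4)]
  have dom: "k_tuple_dominating k ?G (?V - S) \<and> card (?V - S) = (n choose r) - (t + 1)"
    if S: "S \<subseteq> ?V" "card S = t + 1" for S
  proof -
    have finS: "finite S" using S finite_kneser_verts finite_subset by blast
    \<comment> \<open>Whatever a closed neighbourhood has outside \<open>?V - S\<close> lies in
      \<open>S\<close>.\<close>
    have "card (closed_nbhd ?G v - (?V - S)) \<le> t + 1" if "v \<in> ?V" for v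
      unfolding S(2)[symmetric]
      by (rule card_mono[OF finS]) (use kneser_closed_nbhd_subset[OF that] in auto)
    then show ?thesis
      using S finS by (simp add: dom_iff card_Diff_subset card_kneser_verts)
  qed
  have lower: "(n choose r) - (t + 1) \<le> card D" if D: "k_tuple_dominating k ?G D" for D
  proof (rule ccontr)
    assume less: "\<not> ?thesis"
    have DV: "D \<subseteq> ?V" using D by (simp add: k_tuple_dominating_def)
    then have "card (?V - D) = (n choose r) - card D"
      by (simp add: card_Diff_subset card_kneser_verts finite_subset[OF _ finite_kneser_verts])
    \<comment> \<open>One vertex fewer than claimed in \<open>D\<close> means one more than
      \<open>t + 1\<close> outside it, and \<open>t + 2\<close> is the size for which the bound on
      \<open>n\<close> yields a common closed neighbourhood.\<close>
    then have "t + 2 \<le> card (?V - D)" using less by linarith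
    then obtain S where S: "S \<subseteq> ?V - D" "card S = t + 2"
      by (meson obtain_subset_with_card_n)
    have "int n \<ge> (int (card S) + 1) * int r - \<lceil>real (card S) / 2\<rceil>"
      using assms(2) by (simp add: S(2) add.commute)
    then obtain v where v: "v \<in> ?V" "S \<subseteq> closed_nbhd ?G v"
      using kneser_common_closed_nbhd[of S n r] S(1) by auto
    have "finite (closed_nbhd ?G v - D)"
      using finite_subset[OF kneser_closed_nbhd_subset[OF v(1)] finite_kneser_verts] by simp
    then have "t + 2 \<le> card (closed_nbhd ?G v - D)"
      using card_mono[of "closed_nbhd ?G v - D" S] S v(2) by auto
    then show False using D v(1) dom_iff[OF DV] by fastforce
  qed
  \<comment> \<open>Some such \<open>S\<close> has to exist for the minimum to be attained; there
    are more than \<open>t + 1\<close> vertices.\<close>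
  obtain S where "S \<subseteq> ?V" "card S = t + 1"
    using obtain_subset_with_card_n[of "t + 1" ?V] t(2) card_kneser_verts[of n r]
    by (metis less_imp_le)
  then have "k_tuple_domination_number k ?G = (n choose r) - (t + 1)"
    unfolding k_tuple_domination_number_def
    by (intro Least_equality) (use dom lower in blast)+
  then show ?thesis using dom by simp
qed

end
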